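(* Let $t$ be a purchase decision tree with leaf revenues $(r_{t,\ell})_{\ell \in \mathrm{leaves}(t)}$, and let $\mathbf{x} \in \{0,1\}^n$. Let $\ell^*$ denote the leaf of $t$ that the assortment $\{i : x_i = 1\}$ is mapped to. Define $\mathbf{y}_t$ by $y_{t,\ell} = 1$ if $\ell = \ell^*$ and $y_{t,\ell} = 0$ if $\ell \neq \ell^*$. Define $(\boldsymbol{\alpha}_t, \boldsymbol{\beta}_t, \gamma_t)$ by, for $i \in P(t)$, $$\alpha_{t,i} = \begin{cases} \max\{0, \max_{\ell \in \mathrm{left}(i)} r_{t,\ell} - r_{t,\ell^*}\} & \text{if } i \in \mathrm{RP}(\ell^* ),\\ 0 & \text{otherwise,}\end{cases}$$ $$\beta_{t,i} = \begin{cases} \max\{0, \max_{\ell \in \mathrm{right}(i)} r_{t,\ell} - r_{t,\ell^*}\} & \text{if } i \in \mathrm{LP}(\ell^* ),\\ 0 & \text{otherwise,}\end{cases}$$ and $\gamma_t = r_{t,\ell^*}$. Then: (a) $\mathbf{y}_t$ is a feasible solution to the primal subproblem (P'); (b) $(\boldsymbol{\alpha}_t, \boldsymbol{\beta}_t, \gamma_t)$ is a feasible solution to the dual subproblem (D'); and (c) $\mathbf{y}_t$ and $(\boldsymbol{\alpha}_t, \boldsymbol{\beta}_t, \gamma_t)$ are optimal for (P') and (D'), respectively.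
   Context: Let $\mathcal{N} = \{1,\dots,n\}$ be the set of products and $0$ the no-purchase option, with revenues $\rho_i$ ($i \in \mathcal{N}$) and $\rho_0 = 0$. A purchase decision tree $t$ is a finite rooted binary tree in which every non-leaf node (called a split) has exactly one left child and one right child; $\mathrm{splits}(t)$ and $\mathrm{leaves}(t)$ are its sets of splits and leaves. Each split $s$ is labelled with a product $v(t,s) \in \mathcal{N}$ and each leaf $\ell$ with an option $c(t,\ell) \in \mathcal{N} \cup \{0\}$; $r_{t,\ell} = \rho_{c(t,\ell)}$. Standing assumption: if a split $s'$ is a descendant of a split $s$, then $v(t,s) \neq v(t,s')$. An assortment $S \subseteq \mathcal{N}$ is mapped to the leaf reached by starting at the root and, at each split $s$, moving to the left child if $v(t,s) \in S$ and to the right child otherwise. For a split $s$, $\mathrm{left}(s)$ (resp. $\mathrm{right}(s)$) is the set of leaves in the subtree rooted at the left (resp. right) child of $s$. Let $P(t) = \{i \in \mathcal{N} : i = v(t,s) \text{ for some } s \in \mathrm{splits}(t)\}$. For $i \in P(t)$ let $\mathrm{left}(i) = \bigcup_{s:\, v(t,s)=i} \mathrm{left}(s)$ and $\mathrm{right}(i) = \bigcup_{s:\, v(t,s)=i} \mathrm{right}(s)$. For a leaf $\ell$, $\mathrm{LP}(\ell) = \{i \in P(t) : \ell \in \mathrm{left}(i)\}$ (products that must be in the assortment for $\ell$ to be reached) and $\mathrm{RP}(\ell) = \{i \in P(t) : \ell \in \mathrm{right}(i)\}$ (products that must be excluded for $\ell$ to be reached). Primal subproblem (P'): maximize $\sum_{\ell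 \in \mathrm{leaves}(t)} r_{t,\ell}\, y_{t,\ell}$ subject to $\sum_{\ell \in \mathrm{leaves}(t)} y_{t,\ell} = 1$; $\ \sum_{\ell \in \mathrm{left}(i)} y_{t,\ell} \le x_i$ for all $i \in P(t)$; $\ \sum_{\ell \in \mathrm{right}(i)} y_{t,\ell} \le 1 - x_i$ for all $i \in P(t)$; $\ y_{t,\ell} \ge 0$ for all $\ell \in \mathrm{leaves}(t)$. Dual subproblem (D'): minimize $\sum_{i \in P(t)} \alpha_{t,i} x_i + \sum_{i \in P(t)} \beta_{t,i} (1 - x_i) + \gamma_t$ subject to $\sum_{i \in \mathrm{LP}(\ell)} \alpha_{t,i} + \sum_{i \in \mathrm{RP}(\ell)} \beta_{t,i} + \gamma_t \ge r_{t,\ell}$ for all $\ell \in \mathrm{leaves}(t)$; $\alpha_{t,i} \ge 0$, $\beta_{t,i} \ge 0$ for all $i \in P(t)$ ($\gamma_t$ free). *)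

theory Defs
  imports Complex_Main "HOL-Library.Sublist"
begin

datatype tree = Leaf (opt: nat) | Split (prd: nat) tree tree

datatype branch = Lft | Rgt

text \<open>A node of a tree is identified with the path from the root to it; distinct leaves may carry
  the same option, so they cannot be identified with their labels. Descendants of a node are
  its extensions.\<close>

type_synonym node = "branch list"

fun splits :: "tree \<Rightarrow> node set" where
  "splits (Leaf c) = {}"
| "splits (Split i l r) = {[]} \<union> (#) Lft ` splits l \<union> (#) Rgt ` splits r"

fun leaves :: "tree \<Rightarrow> node set" where
  "leaves (Leaf c) = {[]}"
| "leaves (Split i l r) = (#) Lft ` leaves l \<union> (#) Rgt ` leaves r"

fun subtree :: "tree \<Rightarrow> node \<Rightarrow> tree" where
  "subtree t [] = t"
| "subtree (Split i l r) (Lft # p) = subtree l p"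
| "subtree (Split i l r) (Rgt # p) = subtree r p"
| "subtree (Leaf c) (b # p) = undefined"

text \<open>The labels \<open>v(t,s)\<close> and \<open>c(t,l)\<close>; meaningful only for \<open>s \<in> splits t\<close> and
  \<open>l \<in> leaves t\<close> respectively.\<close>

definition split_product :: "tree \<Rightarrow> node \<Rightarrow> nat" where
  "split_product t s = prd (subtree t s)"

definition leaf_option :: "tree \<Rightarrow> node \<Rightarrow> nat" where
  "leaf_option t l = opt (subtree t l)"

text \<open>The products are \<open>{1..n}\<close> and \<open>0\<close> is the no-purchase option.\<close>

definition purchase_tree :: "nat \<Rightarrow> tree \<Rightarrow> bool" where
  "purchase_tree n t \<longleftrightarrow>
     (\<forall>s\<in>splits t. split_product t s \<in> {1..n}) \<and>
     (\<forall>l\<in>leaves t. leaf_option t l \<in> {0..n}) \<and>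
     (\<forall>s\<in>splits t. \<forall>s'\<in>splits t. strict_prefix s s' \<longrightarrow> split_product t s \<noteq> split_product t s')"

fun reached_leaf :: "tree \<Rightarrow> nat set \<Rightarrow> node" where
  "reached_leaf (Leaf c) S = []"
| "reached_leaf (Split i l r) S =
     (if i \<in> S then Lft # reached_leaf l S else Rgt # reached_leaf r S)"

definition left_of_split :: "tree \<Rightarrow> node \<Rightarrow> node set" where
  "left_of_split t s = {l \<in> leaves t. prefix (s @ [Lft]) l}"

definition right_of_split :: "tree \<Rightarrow> node \<Rightarrow> node set" where
  "right_of_split t s = {l \<in> leaves t. prefix (s @ [Rgt]) l}"

definition products :: "tree \<Rightarrow> nat set" where
  "products t = split_product t ` splits t"

definition left_leaves :: "tree \<Rightarrow> nat \<Rightarrow> node set" where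
  "left_leaves t i = (\<Union>s\<in>{s \<in> splits t. split_product t s = i}. left_of_split t s)"

definition right_leaves :: "tree \<Rightarrow> nat \<Rightarrow> node set" where
  "right_leaves t i = (\<Union>s\<in>{s \<in> splits t. split_product t s = i}. right_of_split t s)"

definition LP :: "tree \<Rightarrow> node \<Rightarrow> nat set" where
  "LP t l = {i \<in> products t. l \<in> left_leaves t i}"

definition RP :: "tree \<Rightarrow> node \<Rightarrow> nat set" where
  "RP t l = {i \<in> products t. l \<in> right_leaves t i}"

definition leaf_revenue :: "(nat \<Rightarrow> real) \<Rightarrow> tree \<Rightarrow> node \<Rightarrow> real" where
  "leaf_revenue \<rho> t l = \<rho> (leaf_option t l)"

text \<open>The solutions of the two linear programs are total functions, of which only the values
  on \<open>leaves t\<close> (primal) and on \<open>products t\<close> (dual) matter.\<close>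

definition primal_objective :: "(nat \<Rightarrow> real) \<Rightarrow> tree \<Rightarrow> (node \<Rightarrow> real) \<Rightarrow> real" where
  "primal_objective \<rho> t y = (\<Sum>l\<in>leaves t. leaf_revenue \<rho> t l * y l)"

definition primal_feasible :: "tree \<Rightarrow> (nat \<Rightarrow> real) \<Rightarrow> (node \<Rightarrow> real) \<Rightarrow> bool" where
  "primal_feasible t x y \<longleftrightarrow>
     (\<Sum>l\<in>leaves t. y l) = 1 \<and>
     (\<forall>i\<in>products t. (\<Sum>l\<in>left_leaves t i. y l) \<le> x i) \<and>
     (\<forall>i\<in>products t. (\<Sum>l\<in>right_leaves t i. y l) \<le> 1 - x i) \<and>
     (\<forall>l\<in>leaves t. y l \<ge> 0)"

definition primal_optimal :: "(nat \<Rightarrow> real) \<Rightarrow> tree \<Rightarrow> (nat \<Rightarrow> real) \<Rightarrow> (node \<Rightarrow> real) \<Rightarrow> bool" where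
  "primal_optimal \<rho> t x y \<longleftrightarrow>
     primal_feasible t x y \<and>
     (\<forall>y'. primal_feasible t x y' \<longrightarrow> primal_objective \<rho> t y' \<le> primal_objective \<rho> t y)"

definition dual_objective ::
    "tree \<Rightarrow> (nat \<Rightarrow> real) \<Rightarrow> (nat \<Rightarrow> real) \<Rightarrow> (nat \<Rightarrow> real) \<Rightarrow> real \<Rightarrow> real" where
  "dual_objective t x \<alpha> \<beta> \<gamma> =
     (\<Sum>i\<in>products t. \<alpha> i * x i) + (\<Sum>i\<in>products t. \<beta> i * (1 - x i)) + \<gamma>"

definition dual_feasible ::
    "(nat \<Rightarrow> real) \<Rightarrow> tree \<Rightarrow> (nat \<Rightarrow> real) \<Rightarrow> (nat \<Rightarrow> real) \<Rightarrow> real \<Rightarrow> bool" where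
  "dual_feasible \<rho> t \<alpha> \<beta> \<gamma> \<longleftrightarrow>
     (\<forall>l\<in>leaves t. (\<Sum>i\<in>LP t l. \<alpha> i) + (\<Sum>i\<in>RP t l. \<beta> i) + \<gamma> \<ge> leaf_revenue \<rho> t l) \<and>
     (\<forall>i\<in>products t. \<alpha> i \<ge> 0 \<and> \<beta> i \<ge> 0)"

definition dual_optimal ::
    "(nat \<Rightarrow> real) \<Rightarrow> tree \<Rightarrow> (nat \<Rightarrow> real) \<Rightarrow> (nat \<Rightarrow> real) \<Rightarrow> (nat \<Rightarrow> real) \<Rightarrow> real \<Rightarrow> bool" where
  "dual_optimal \<rho> t x \<alpha> \<beta> \<gamma> \<longleftrightarrow>
     dual_feasible \<rho> t \<alpha> \<beta> \<gamma> \<and>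
     (\<forall>\<alpha>' \<beta>' \<gamma>'. dual_feasible \<rho> t \<alpha>' \<beta>' \<gamma>' \<longrightarrow>
        dual_objective t x \<alpha> \<beta> \<gamma> \<le> dual_objective t x \<alpha>' \<beta>' \<gamma>')"

lemma finite_splits: "finite (splits t)"
  by (induction t) auto

lemma finite_leaves: "finite (leaves t)"
  by (induction t) auto

lemma reached_leaf_in_leaves: "reached_leaf t S \<in> leaves t"
  by (induction t) auto

lemma leaves_below_split:
  "s \<in> splits t \<Longrightarrow> left_of_split t s \<noteq> {} \<and> right_of_split t s \<noteq> {}"
proof (induction t arbitrary: s)
  case (Leaf c)
  then show ?case by simp
next
  case (Split i l r)
  have "leaves u \<noteq> {}" for u
    using reached_leaf_in_leaves by blast
  then obtain p q where "p \<in> leaves l" "q \<in> leaves r"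
    by blast
  have sub: "left_of_split (Split i l r) (Lft # u) = (#) Lft ` left_of_split l u"
      "right_of_split (Split i l r) (Lft # u) = (#) Lft ` right_of_split l u"
      "left_of_split (Split i l r) (Rgt # u) = (#) Rgt ` left_of_split r u"
      "right_of_split (Split i l r) (Rgt # u) = (#) Rgt ` right_of_split r u" for u
    by (auto simp: left_of_split_def right_of_split_def)
  have root: "left_of_split (Split i l r) [] = (#) Lft ` leaves l"
      "right_of_split (Split i l r) [] = (#) Rgt ` leaves r"
    by (auto simp: left_of_split_def right_of_split_def)
  from Split.prems consider "s = []" | u where "s = Lft # u" "u \<in> splits l"
      | u where "s = Rgt # u" "u \<in> splits r"
    by auto
  then show ?case
    using \<open>p \<in> leaves l\<close> \<open>q \<in> leaves r\<close>
    by cases (auto simp: sub root dest: Split.IH)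
qed

text \<open>Hence the maxima of the leaf revenues over \<open>left_leaves t i\<close> and \<open>right_leaves t i\<close>
  are over finite nonempty sets for every \<open>i \<in> products t\<close>.\<close>

lemma left_right_leaves_finite_nonempty:
  assumes "i \<in> products t"
  shows "finite (left_leaves t i)" "finite (right_leaves t i)"
    and "left_leaves t i \<noteq> {}" "right_leaves t i \<noteq> {}"
proof -
  have "left_leaves t i \<subseteq> leaves t" "right_leaves t i \<subseteq> leaves t"
    by (auto simp: left_leaves_def right_leaves_def left_of_split_def right_of_split_def)
  then show "finite (left_leaves t i)" "finite (right_leaves t i)"
    using finite_leaves finite_subset by blast+
  obtain s where "s \<in> splits t" "split_product t s = i"
    using assms by (auto simp: products_def)
  then show "left_leaves t i \<noteq> {}" "right_leaves t i \<noteq> {}"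
    using leaves_below_split[of s t] by (auto simp: left_leaves_def right_leaves_def)
qed

end

theory Submission
  imports Defs
begin

text \<open>
  The argument is weak duality together with a pair of solutions of equal objective value.

  For feasibility of the primal candidate only the one leaf \<open>l0\<close> with \<open>y l0 = 1\<close> matters: lying in
  \<open>left_leaves t i\<close> forces \<open>i\<close> into the assortment, so \<open>x i = 1\<close>, and lying in \<open>right_leaves t i\<close>
  forces it out, so \<open>x i = 0\<close> (\<open>product_of_left_turn_in_assortment\<close>,
  \<open>product_of_right_turn_notin_assortment\<close>).

  For feasibility of the dual candidate, the covering constraint of \<open>l0\<close> holds because
  \<open>\<gamma> = r\<^sub>l\<^sub>0\<close>. Any other leaf \<open>l\<close> separates from \<open>l0\<close> at some split, say with product \<open>i\<close>
  (\<open>distinct_leaves_separated\<close>). If \<open>l\<close> goes left there and \<open>l0\<close> right, then \<open>i \<in> RP l0\<close>,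
  so \<open>\<alpha> i\<close> is at least the best revenue in \<open>left_leaves t i\<close> minus \<open>r\<^sub>l\<^sub>0\<close>, and \<open>i \<in> LP l\<close>, so
  this single term already lifts the left-hand side to \<open>r\<^sub>l\<close>; the other case is symmetric with
  \<open>\<beta>\<close>. This construction works from every leaf \<open>l0\<close>, reached or not
  (\<open>dual_solution_feasible\<close>).

  The two objective values agree by complementary slackness: \<open>\<alpha> i\<close> can be nonzero only if
  \<open>i \<in> RP l0\<close>, where \<open>x i = 0\<close>, and \<open>\<beta> i\<close> only if \<open>i \<in> LP l0\<close>, where \<open>1 - x i = 0\<close>. Both objectives
  are therefore \<open>r\<^sub>l\<^sub>0\<close>, and weak duality makes both solutions optimal.
\<close>

section \<open>Leaves and the splits above them\<close>

lemma split_product_simps [simp]: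
  "split_product (Split i l r) [] = i"
  "split_product (Split i l r) (Lft # s) = split_product l s"
  "split_product (Split i l r) (Rgt # s) = split_product r s"
  by (simp_all add: split_product_def)

lemma mem_left_leaves_iff:
  "l \<in> left_leaves t i \<longleftrightarrow>
     l \<in> leaves t \<and> (\<exists>s\<in>splits t. split_product t s = i \<and> prefix (s @ [Lft]) l)"
  by (auto simp: left_leaves_def left_of_split_def)

lemma mem_right_leaves_iff:
  "l \<in> right_leaves t i \<longleftrightarrow>
     l \<in> leaves t \<and> (\<exists>s\<in>splits t. split_product t s = i \<and> prefix (s @ [Rgt]) l)"
  by (auto simp: right_leaves_def right_of_split_def)

lemma product_of_left_turn_in_assortment:
  assumes "reached_leaf t S \<in> left_leaves t i"
  shows "i \<in> S"
proof -
  have "split_product t s \<in> S"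
    if "s \<in> splits t" "prefix (s @ [Lft]) (reached_leaf t S)" for s
    using that by (induction t arbitrary: s) (auto split: if_splits)
  then show ?thesis
    using assms by (auto simp: mem_left_leaves_iff)
qed

lemma product_of_right_turn_notin_assortment:
  assumes "reached_leaf t S \<in> right_leaves t i"
  shows "i \<notin> S"
proof -
  have "split_product t s \<notin> S"
    if "s \<in> splits t" "prefix (s @ [Rgt]) (reached_leaf t S)" for s
    using that by (induction t arbitrary: s) (auto split: if_splits)
  then show ?thesis
    using assms by (auto simp: mem_right_leaves_iff)
qed

text \<open>Neither of two distinct leaves is an ancestor of the other, so the paths to them part at
  their last common ancestor, which is a split.\<close>

lemma distinct_leaves_part_at_split:
  assumes "l \<in> leaves t" "l' \<in> leaves t" "l \<noteq> l'"
  shows "\<exists>s\<in>splits t. prefix (s @ [Lft]) l \<and> prefix (s @ [Rgt]) l' \<or>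
                      prefix (s @ [Rgt]) l \<and> prefix (s @ [Lft]) l'"
  using assms
proof (induction t arbitrary: l l')
  case (Leaf c)
  then show ?case by simp
next
  case (Split i u v)
  from Split.prems(1,2) consider
      p p' where "l = Lft # p" "l' = Lft # p'" "p \<in> leaves u" "p' \<in> leaves u"
    | p p' where "l = Rgt # p" "l' = Rgt # p'" "p \<in> leaves v" "p' \<in> leaves v"
    | p p' where "l = Lft # p" "l' = Rgt # p'"
    | p p' where "l = Rgt # p" "l' = Lft # p'"
    unfolding leaves.simps by blast
  then show ?case
  proof cases
    case 1
    with Split.IH(1)[of p p'] Split.prems(3) show ?thesis by (auto simp: bex_Un)
  next
    case 2
    with Split.IH(2)[of p p'] Split.prems(3) show ?thesis by (auto simp: bex_Un)
  qed (auto simp: bex_Un)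
qed

lemma distinct_leaves_separated:
  assumes "l \<in> leaves t" "l' \<in> leaves t" "l \<noteq> l'"
  shows "\<exists>i. i \<in> LP t l \<inter> RP t l' \<or> i \<in> RP t l \<inter> LP t l'"
proof -
  obtain s where s: "s \<in> splits t"
    "prefix (s @ [Lft]) l \<and> prefix (s @ [Rgt]) l' \<or> prefix (s @ [Rgt]) l \<and> prefix (s @ [Lft]) l'"
    using distinct_leaves_part_at_split[OF assms] by blast
  then have "split_product t s \<in> LP t l \<inter> RP t l' \<or> split_product t s \<in> RP t l \<inter> LP t l'"
    using assms(1,2)
    by (auto simp: LP_def RP_def products_def mem_left_leaves_iff mem_right_leaves_iff)
  then show ?thesis ..
qed

lemma finite_products: "finite (products t)"
  by (simp add: products_def finite_splits)

section \<open>Weak duality\<close>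

text \<open>Weighting the covering constraint of each leaf \<open>l\<close> by \<open>y l\<close> and summing over the leaves, the
  coefficient of \<open>\<alpha> i\<close> becomes the mass of \<open>y\<close> on \<open>left_leaves t i\<close>. The family \<open>F\<close>
  stands for \<open>left_leaves t\<close>, and for \<open>right_leaves t\<close> in the case of \<open>\<beta>\<close>.\<close>

lemma sum_over_leaves_by_product:
  fixes a :: "nat \<Rightarrow> real" and y :: "node \<Rightarrow> real"
  assumes "\<And>i. F i \<subseteq> leaves t"
  shows "(\<Sum>l\<in>leaves t. (\<Sum>i\<in>{i \<in> products t. l \<in> F i}. a i) * y l) =
         (\<Sum>i\<in>products t. a i * (\<Sum>l\<in>F i. y l))"
proof -
  have F: "{l \<in> leaves t. l \<in> F i} = F i" for i
    using assms by blast
  have "(\<Sum>l\<in>leaves t. (\<Sum>i\<in>{i \<in> products t. l \<in> F i}. a i) * y l) =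
        (\<Sum>l\<in>leaves t. \<Sum>i\<in>{i \<in> products t. l \<in> F i}. a i * y l)"
    by (simp add: sum_distrib_right)
  also have "\<dots> = (\<Sum>i\<in>products t. \<Sum>l\<in>{l \<in> leaves t. l \<in> F i}. a i * y l)"
    by (rule sum.swap_restrict) (simp_all add: finite_leaves finite_products)
  finally show ?thesis
    by (simp add: F sum_distrib_left)
qed

lemma weak_duality:
  assumes y: "primal_feasible t x y" and d: "dual_feasible \<rho> t \<alpha> \<beta> \<gamma>"
  shows "primal_objective \<rho> t y \<le> dual_objective t x \<alpha> \<beta> \<gamma>"
proof -
  have "primal_objective \<rho> t y \<le>
        (\<Sum>l\<in>leaves t. ((\<Sum>i\<in>LP t l. \<alpha> i) + (\<Sum>i\<in>RP t l. \<beta> i) + \<gamma>) * y l)"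
    unfolding primal_objective_def using y d
    by (intro sum_mono mult_right_mono) (auto simp: primal_feasible_def dual_feasible_def)
  also have "\<dots> = (\<Sum>l\<in>leaves t. (\<Sum>i\<in>LP t l. \<alpha> i) * y l) +
                  (\<Sum>l\<in>leaves t. (\<Sum>i\<in>RP t l. \<beta> i) * y l) + \<gamma> * (\<Sum>l\<in>leaves t. y l)"
    by (simp add: distrib_right sum.distrib sum_distrib_left)
  also have "\<dots> = (\<Sum>i\<in>products t. \<alpha> i * (\<Sum>l\<in>left_leaves t i. y l)) +
                  (\<Sum>i\<in>products t. \<beta> i * (\<Sum>l\<in>right_leaves t i. y l)) + \<gamma>"
  proof -
    have "left_leaves t i \<subseteq> leaves t" "right_leaves t i \<subseteq> leaves t" for i
      by (auto simp: mem_left_leaves_iff mem_right_leaves_iff)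
    then show ?thesis
      using y by (simp add: LP_def RP_def sum_over_leaves_by_product primal_feasible_def)
  qed
  also have "\<dots> \<le> dual_objective t x \<alpha> \<beta> \<gamma>"
    unfolding dual_objective_def using y d
    by (intro add_mono sum_mono mult_left_mono order_refl)
       (auto simp: primal_feasible_def dual_feasible_def)
  finally show ?thesis .
qed

lemma optimal_if_objectives_equal:
  assumes "primal_feasible t x y" "dual_feasible \<rho> t \<alpha> \<beta> \<gamma>"
    and "primal_objective \<rho> t y = dual_objective t x \<alpha> \<beta> \<gamma>"
  shows "primal_optimal \<rho> t x y" "dual_optimal \<rho> t x \<alpha> \<beta> \<gamma>"
  using assms weak_duality unfolding primal_optimal_def dual_optimal_def by metis+

section \<open>The candidate solutions\<close>

text \<open>Whichever product separates \<open>l\<close> from \<open>l0\<close>, its dual variable enters the covering constraint of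
  \<open>l\<close> with a value of at least the revenue gap; every other term is nonnegative.\<close>

lemma dual_solution_feasible:
  assumes l0: "l0 \<in> leaves t"
    and \<alpha>: "\<And>i. i \<in> products t \<Longrightarrow> \<alpha> i =
           (if i \<in> RP t l0
            then max 0 ((MAX l\<in>left_leaves t i. leaf_revenue \<rho> t l) - leaf_revenue \<rho> t l0)
            else 0)"
    and \<beta>: "\<And>i. i \<in> products t \<Longrightarrow> \<beta> i =
           (if i \<in> LP t l0
            then max 0 ((MAX l\<in>right_leaves t i. leaf_revenue \<rho> t l) - leaf_revenue \<rho> t l0)
            else 0)"
  shows "dual_feasible \<rho> t \<alpha> \<beta> (leaf_revenue \<rho> t l0)"
proof -
  let ?r = "leaf_revenue \<rho> t"
  have nonneg: "\<alpha> i \<ge> 0" "\<beta> i \<ge> 0" if "i \<in> products t" for i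
    using that by (simp_all add: \<alpha> \<beta>)
  have LP_sub: "LP t l \<subseteq> products t" and RP_sub: "RP t l \<subseteq> products t" for l
    by (auto simp: LP_def RP_def)
  have fin: "finite (LP t l)" "finite (RP t l)" for l
    using finite_subset[OF LP_sub finite_products] finite_subset[OF RP_sub finite_products] by auto
  have sums: "(\<Sum>i\<in>LP t l. \<alpha> i) \<ge> 0" "(\<Sum>i\<in>RP t l. \<beta> i) \<ge> 0" for l
    using nonneg subsetD[OF LP_sub] subsetD[OF RP_sub] by (simp_all add: sum_nonneg)
  have "(\<Sum>i\<in>LP t l. \<alpha> i) + (\<Sum>i\<in>RP t l. \<beta> i) + ?r l0 \<ge> ?r l" if l: "l \<in> leaves t" for l
  proof (cases "l = l0")
    case True
    with sums[of l] show ?thesis by simp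
  next
    case False
    then consider i where "i \<in> LP t l" "i \<in> RP t l0" | i where "i \<in> RP t l" "i \<in> LP t l0"
      using distinct_leaves_separated[OF l l0] by blast
    then show ?thesis
    proof cases
      case 1
      then have i: "i \<in> products t" "l \<in> left_leaves t i"
        by (auto simp: LP_def)
      have "?r l \<le> (MAX l\<in>left_leaves t i. ?r l)"
        using i left_right_leaves_finite_nonempty(1) by simp
      also have "\<dots> - ?r l0 \<le> \<alpha> i"
        using 1 i by (simp add: \<alpha>)
      also have "\<alpha> i \<le> (\<Sum>i\<in>LP t l. \<alpha> i)"
        using 1 fin nonneg subsetD[OF LP_sub] by (intro member_le_sum) auto
      finally show ?thesis
        using sums(2)[of l] by linarith
    next
      case 2
      then have i: "i \<in> products t" "l \<in> right_leaves t i"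
        by (auto simp: RP_def)
      have "?r l \<le> (MAX l\<in>right_leaves t i. ?r l)"
        using i left_right_leaves_finite_nonempty(2) by simp
      also have "\<dots> - ?r l0 \<le> \<beta> i"
        using 2 i by (simp add: \<beta>)
      also have "\<beta> i \<le> (\<Sum>i\<in>RP t l. \<beta> i)"
        using 2 fin nonneg subsetD[OF RP_sub] by (intro member_le_sum) auto
      finally show ?thesis
        using sums(1)[of l] by linarith
    qed
  qed
  with nonneg show ?thesis
    by (simp add: dual_feasible_def)
qed

theorem theorem6:
  fixes n :: nat and \<rho> :: "nat \<Rightarrow> real" and t :: tree and x :: "nat \<Rightarrow> real"
    and y :: "node \<Rightarrow> real" and \<alpha> \<beta> :: "nat \<Rightarrow> real" and \<gamma> :: real and l0 :: node
  assumes "\<rho> 0 = 0"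
    and "purchase_tree n t"
    and "\<forall>i\<in>{1..n}. x i \<in> {0, 1}"
    and "l0 = reached_leaf t {i \<in> {1..n}. x i = 1}"
    and "\<forall>l\<in>leaves t. y l = (if l = l0 then 1 else 0)"
    and "\<forall>i\<in>products t. \<alpha> i =
           (if i \<in> RP t l0
            then max 0 ((MAX l\<in>left_leaves t i. leaf_revenue \<rho> t l) - leaf_revenue \<rho> t l0)
            else 0)"
    and "\<forall>i\<in>products t. \<beta> i =
           (if i \<in> LP t l0
            then max 0 ((MAX l\<in>right_leaves t i. leaf_revenue \<rho> t l) - leaf_revenue \<rho> t l0)
            else 0)"
    and "\<gamma> = leaf_revenue \<rho> t l0"
  shows "primal_feasible t x y \<and>
         dual_feasible \<rho> t \<alpha> \<beta> \<gamma> \<and>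
         primal_optimal \<rho> t x y \<and>
         dual_optimal \<rho> t x \<alpha> \<beta> \<gamma>"
proof -
  let ?S = "{i \<in> {1..n}. x i = 1}"
  let ?r = "leaf_revenue \<rho> t"
  have l0: "l0 \<in> leaves t"
    using assms(4) reached_leaf_in_leaves by simp
  have x01: "x i = 0 \<or> x i = 1" and in_S: "i \<in> ?S \<longleftrightarrow> x i = 1" if "i \<in> products t" for i
    using that assms(2,3) by (auto simp: products_def purchase_tree_def)
  have x_left: "x i = 1" if "i \<in> products t" "l0 \<in> left_leaves t i" for i
    using that product_of_left_turn_in_assortment[of t ?S i] in_S assms(4) by simp
  have x_right: "x i = 0" if "i \<in> products t" "l0 \<in> right_leaves t i" for i
    using that product_of_right_turn_notin_assortment[of t ?S i] in_S x01 assms(4) by blast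

  have sum_y: "(\<Sum>l\<in>A. f l * y l) = (if l0 \<in> A then f l0 else 0)"
    if "A \<subseteq> leaves t" for A and f :: "node \<Rightarrow> real"
  proof -
    have "(\<Sum>l\<in>A. f l * y l) = (\<Sum>l\<in>A. if l = l0 then f l else 0)"
      using that assms(5) by (intro sum.cong) auto
    then show ?thesis
      using finite_subset[OF that finite_leaves] by simp
  qed
  have mass: "(\<Sum>l\<in>A. y l) = (if l0 \<in> A then 1 else 0)" if "A \<subseteq> leaves t" for A
    using sum_y[OF that, of "\<lambda>_. 1"] by simp
  have sub: "left_leaves t i \<subseteq> leaves t" "right_leaves t i \<subseteq> leaves t" for i
    by (auto simp: mem_left_leaves_iff mem_right_leaves_iff)

  have primal: "primal_feasible t x y"
    unfolding primal_feasible_def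
  proof (intro conjI ballI)
    show "(\<Sum>l\<in>leaves t. y l) = 1"
      using l0 by (simp add: mass)
    show "(\<Sum>l\<in>left_leaves t i. y l) \<le> x i" if "i \<in> products t" for i
      using x_left[OF that] x01[OF that] by (auto simp: mass sub)
    show "(\<Sum>l\<in>right_leaves t i. y l) \<le> 1 - x i" if "i \<in> products t" for i
      using x_right[OF that] x01[OF that] by (auto simp: mass sub)
    show "y l \<ge> 0" if "l \<in> leaves t" for l
      using that assms(5) by simp
  qed

  have dual: "dual_feasible \<rho> t \<alpha> \<beta> \<gamma>"
    unfolding assms(8) using l0 assms(6,7) by (intro dual_solution_feasible) blast+

  have "\<alpha> i * x i = 0" "\<beta> i * (1 - x i) = 0" if "i \<in> products t" for i
    using that x_left x_right assms(6,7) by (auto simp: LP_def RP_def)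
  then have "dual_objective t x \<alpha> \<beta> \<gamma> = ?r l0"
    using assms(8) by (simp add: dual_objective_def sum.neutral del: mult_eq_0_iff)
  moreover have "primal_objective \<rho> t y = ?r l0"
    using l0 by (simp add: primal_objective_def sum_y)
  ultimately show ?thesis
    using primal dual optimal_if_objectives_equal[OF primal dual] by simp
qed

end
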